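(* Let $\succ$ be an admissible monomial ordering on the set $\mathbb{M}$ of monomials in $x_1,\dots,x_n$. For every finite set $U\subset\mathbb{M}$ and every $u\in U$, declare the variable $x_i$ nonmultiplicative for $u$ if there is $v\in U$ such that $v\prec u$ and $\deg_i(u)<\deg_i(v)$, and multiplicative otherwise; let $D_\succ(u,U)$ be the submonoid of $\mathbb{M}$ generated by the variables that are multiplicative for $u$. Then $D_\succ$ is an involutive division on $\mathbb{M}$.
   Context: $\mathbb{M}=\{x_1^{d_1}\cdots x_n^{d_n}\mid d_i\in\mathbb{Z}_{\ge 0}\}$ is the monoid of monomials in $n$ variables, and $\deg_i(u)$ is the degree of $x_i$ in $u$. An admissible monomial ordering is a total ordering $\succ$ on $\mathbb{M}$, compatible with multiplication, with $u\succ 1$ for all $u\ne 1$. All monomial sets are finite. An involutive division $L$ on $\mathbb{M}$ is given if for any finite set $U\subset\mathbb{M}$ and any $u\in U$ there is given a submonoid $L(u,U)$ of $\mathbb{M}$ satisfying: (a) if $w\in L(u,U)$ and $v\mid w$, then $v\in L(u,U)$; (b) if $u,v\in U$ and $uL(u,U)\cap vL(v,U)\neq\emptyset$, then $u\in vL(v,U)$ or $v\in uL(u,U)$; (c) if $v\in U$ and $v\in uL(u,U)$, then $L(v,U)\subseteq L(u,U)$; (d) if $V\subseteq U$, then $L(u,U)\subseteq L(u,V)$ for all $u\in V$. *)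

theory Defs
  imports "HOL-Algebra.Coset" "HOL-Algebra.Divisibility" "HOL-Library.Poly_Mapping" "HOL.Hull"
begin

text \<open>
  A monomial is represented by its exponent vector: \<open>lookup u i\<close> is the degree of
  \<open>x\<^sub>i\<close> in \<open>u\<close>, and the product of monomials is the sum of exponent vectors.
\<close>

definition monomials :: "nat \<Rightarrow> (nat \<Rightarrow>\<^sub>0 nat) monoid" where
  "monomials n = \<lparr>carrier = {u. Poly_Mapping.keys u \<subseteq> {1..n}}, mult = (+), one = 0\<rparr>"

lemma comm_monoid_monomials: "comm_monoid (monomials n)"
proof (rule comm_monoidI)
  fix u v :: "nat \<Rightarrow>\<^sub>0 nat"
  assume "u \<in> carrier (monomials n)" "v \<in> carrier (monomials n)"
  then show "u \<otimes>\<^bsub>monomials n\<^esub> v \<in> carrier (monomials n)"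
    using Poly_Mapping.keys_add[of u v] by (auto simp: monomials_def)
qed (simp_all add: monomials_def ac_simps)

definition variable :: "nat \<Rightarrow> (nat \<Rightarrow>\<^sub>0 nat)" where
  "variable i = Poly_Mapping.single i 1"

text \<open>The argument is the strict relation \<open>u \<succ> v\<close>; only its values on the carrier matter.\<close>

definition admissible_ordering ::
    "nat \<Rightarrow> ((nat \<Rightarrow>\<^sub>0 nat) \<Rightarrow> (nat \<Rightarrow>\<^sub>0 nat) \<Rightarrow> bool) \<Rightarrow> bool" where
  "admissible_ordering n gt \<longleftrightarrow>
     (let M = monomials n in
        irreflp_on (carrier M) gt \<and> transp_on (carrier M) gt \<and> totalp_on (carrier M) gt \<and>
        (\<forall>u\<in>carrier M. \<forall>v\<in>carrier M. \<forall>w\<in>carrier M.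
           gt u v \<longrightarrow> gt (u \<otimes>\<^bsub>M\<^esub> w) (v \<otimes>\<^bsub>M\<^esub> w)) \<and>
        (\<forall>u\<in>carrier M. u \<noteq> \<one>\<^bsub>M\<^esub> \<longrightarrow> gt u \<one>\<^bsub>M\<^esub>))"

text \<open>The values \<open>L u U\<close> with \<open>U\<close> infinite, or with \<open>u \<notin> U\<close>, are unconstrained.\<close>

definition involutive_division ::
    "nat \<Rightarrow> ((nat \<Rightarrow>\<^sub>0 nat) \<Rightarrow> (nat \<Rightarrow>\<^sub>0 nat) set \<Rightarrow> (nat \<Rightarrow>\<^sub>0 nat) set) \<Rightarrow> bool" where
  "involutive_division n L \<longleftrightarrow>
     (let M = monomials n in
        \<forall>U. finite U \<and> U \<subseteq> carrier M \<longrightarrow>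
          (\<forall>u\<in>U. submonoid (L u U) M) \<and>
          (\<forall>u\<in>U. \<forall>w\<in>L u U. \<forall>v\<in>carrier M. v divides\<^bsub>M\<^esub> w \<longrightarrow> v \<in> L u U) \<and>
          (\<forall>u\<in>U. \<forall>v\<in>U. (u <#\<^bsub>M\<^esub> L u U) \<inter> (v <#\<^bsub>M\<^esub> L v U) \<noteq> {} \<longrightarrow>
             u \<in> v <#\<^bsub>M\<^esub> L v U \<or> v \<in> u <#\<^bsub>M\<^esub> L u U) \<and>
          (\<forall>u\<in>U. \<forall>v\<in>U. v \<in> u <#\<^bsub>M\<^esub> L u U \<longrightarrow> L v U \<subseteq> L u U) \<and>
          (\<forall>V\<subseteq>U. \<forall>u\<in>V. L u U \<subseteq> L u V))"

definition nonmultiplicative ::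
    "((nat \<Rightarrow>\<^sub>0 nat) \<Rightarrow> (nat \<Rightarrow>\<^sub>0 nat) \<Rightarrow> bool) \<Rightarrow> (nat \<Rightarrow>\<^sub>0 nat) \<Rightarrow> (nat \<Rightarrow>\<^sub>0 nat) set \<Rightarrow> nat \<Rightarrow> bool"
  where "nonmultiplicative gt u U i \<longleftrightarrow>
    (\<exists>v\<in>U. gt u v \<and> Poly_Mapping.lookup u i < Poly_Mapping.lookup v i)"

definition ordering_division ::
    "nat \<Rightarrow> ((nat \<Rightarrow>\<^sub>0 nat) \<Rightarrow> (nat \<Rightarrow>\<^sub>0 nat) \<Rightarrow> bool) \<Rightarrow>
     (nat \<Rightarrow>\<^sub>0 nat) \<Rightarrow> (nat \<Rightarrow>\<^sub>0 nat) set \<Rightarrow> (nat \<Rightarrow>\<^sub>0 nat) set" where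
  "ordering_division n gt u U =
     (\<lambda>H. submonoid H (monomials n)) hull
       {variable i | i. i \<in> {1..n} \<and> \<not> nonmultiplicative gt u U i}"

end

theory Submission
  imports Defs
begin

text \<open>
  A set of variables generates the monoid of the monomials supported on it, so membership in
  \<open>D\<^sub>\<succ>(u,U)\<close> is a condition on supports: \<open>w\<close> lies in it iff every variable of \<open>w\<close> is
  multiplicative for \<open>u\<close>.  This form is visibly closed under divisors, and shrinking \<open>U\<close> removes
  obstructions, which gives axioms (a) and (d).

  For (b), let \<open>ua = vb\<close> with \<open>u \<succ> v\<close>.  A variable of \<open>a\<close> is multiplicative for \<open>u\<close>, so
  the smaller element \<open>v\<close> cannot exceed \<open>u\<close> there; outside the support of \<open>a\<close> the exponents of
  \<open>v\<close> are bounded by those of \<open>vb = ua\<close>, hence by those of \<open>u\<close>.  Thus \<open>u = vc\<close>, and cancelling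
  \<open>v\<close> in \<open>vb = vca\<close> shows that \<open>c\<close> divides \<open>b\<close>; so \<open>u\<close> lies in the cone of \<open>v\<close>.

  For (c), let \<open>v = ua\<close>.  A variable nonmultiplicative for \<open>u\<close>, as witnessed by \<open>w \<prec> u\<close>, is absent
  from \<open>a\<close>, so \<open>u\<close> and \<open>v\<close> have the same degree in it; and \<open>w \<prec> u \<preceq> ua = v\<close>.  Thus
  \<open>w\<close> is also a witness for \<open>v\<close>.
\<close>

lemma carrier_monomials [simp]: "w \<in> carrier (monomials n) \<longleftrightarrow> Poly_Mapping.keys w \<subseteq> {1..n}"
  by (simp add: monomials_def)

lemma mult_monomials [simp]: "u \<otimes>\<^bsub>monomials n\<^esub> v = u + v"
  by (simp add: monomials_def)

lemma one_monomials [simp]: "\<one>\<^bsub>monomials n\<^esub> = 0"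
  by (simp add: monomials_def)

lemma mem_l_coset_monomials: "w \<in> u <#\<^bsub>monomials n\<^esub> H \<longleftrightarrow> (\<exists>h\<in>H. w = u + h)"
  by (auto simp: l_coset_def)

lemma keys_add_nat:
  "Poly_Mapping.keys (u + v) = Poly_Mapping.keys u \<union> Poly_Mapping.keys (v :: 'a \<Rightarrow>\<^sub>0 nat)"
  by (auto simp: in_keys_iff lookup_add)

lemma sum_single_lookup:
  "(\<Sum>i\<in>Poly_Mapping.keys w. Poly_Mapping.single i (Poly_Mapping.lookup w i)) = w"
  by (rule poly_mapping_eqI)
    (simp add: lookup_sum lookup_single when_def in_keys_iff if_distrib)

lemma submonoid_keys_subset:
  "X \<subseteq> {1..n} \<Longrightarrow> submonoid {w. Poly_Mapping.keys w \<subseteq> X} (monomials n)"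
  by unfold_locales (auto simp: keys_add_nat)

text \<open>
  A submonoid containing the variables in \<open>X\<close> contains their powers, and every monomial supported
  on \<open>X\<close> is a finite product of such powers.
\<close>

lemma hull_variables:
  assumes "X \<subseteq> {1..n}"
  shows "(\<lambda>H. submonoid H (monomials n)) hull {variable i | i. i \<in> X} = {w. Poly_Mapping.keys w \<subseteq> X}"
proof (rule hull_unique)
  show "{variable i | i. i \<in> X} \<subseteq> {w. Poly_Mapping.keys w \<subseteq> X}"
    by (auto simp: variable_def split: if_splits)
  show "submonoid {w. Poly_Mapping.keys w \<subseteq> X} (monomials n)"
    using assms by (rule submonoid_keys_subset)
next
  fix H
  assume gens: "{variable i | i. i \<in> X} \<subseteq> H" and "submonoid H (monomials n)"
  then interpret submonoid H "monomials n" by simp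
  have zero: "0 \<in> H" using one_closed by simp
  have add: "u + v \<in> H" if "u \<in> H" "v \<in> H" for u v using m_closed[OF that] by simp
  have power: "Poly_Mapping.single i k \<in> H" if "i \<in> X" for i k
  proof (induction k)
    case (Suc k)
    have "variable i \<in> H" using that gens by blast
    then have "variable i + Poly_Mapping.single i k \<in> H" using Suc by (rule add)
    then show ?case by (simp add: variable_def flip: single_add)
  qed (simp add: zero)
  have "w \<in> H" if "Poly_Mapping.keys w \<subseteq> X" for w
  proof -
    have "(\<Sum>i\<in>A. Poly_Mapping.single i (Poly_Mapping.lookup w i)) \<in> H" if "finite A" "A \<subseteq> X" for A
      using that by (induction A rule: finite_induct) (auto intro: zero add power)
    from this[of "Poly_Mapping.keys w"] that show ?thesis
      by (simp add: sum_single_lookup)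
  qed
  then show "{w. Poly_Mapping.keys w \<subseteq> X} \<subseteq> H" by blast
qed

lemma mem_ordering_division_iff:
  "w \<in> ordering_division n gt u U \<longleftrightarrow>
     (\<forall>i\<in>Poly_Mapping.keys w. i \<in> {1..n} \<and> \<not> nonmultiplicative gt u U i)"
proof -
  have "ordering_division n gt u U =
      {w. Poly_Mapping.keys w \<subseteq> {i \<in> {1..n}. \<not> nonmultiplicative gt u U i}}"
    unfolding ordering_division_def
    by (subst hull_variables[symmetric]) (auto intro!: arg_cong2[where f = "(hull)"])
  then show ?thesis by auto
qed

lemma submonoid_ordering_division:
  "submonoid (ordering_division n gt u U) (monomials n)"
  by unfold_locales (auto simp: mem_ordering_division_iff keys_add_nat)

lemma ordering_division_factor_closed:
  "v + c \<in> ordering_division n gt u U \<Longrightarrow> v \<in> ordering_division n gt u U"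
  by (simp add: mem_ordering_division_iff keys_add_nat)

lemma ordering_division_antimono:
  "V \<subseteq> U \<Longrightarrow> ordering_division n gt u U \<subseteq> ordering_division n gt u V"
  unfolding subset_iff mem_ordering_division_iff nonmultiplicative_def by blast

text \<open>
  When two cones meet, the \<open>\<succ>\<close>-larger generator lies in the cone of the smaller one.  The point is
  that \<open>v\<close> divides \<open>u\<close>: where \<open>a\<close> has positive degree, \<open>v\<close> would otherwise be an obstruction
  for \<open>u\<close>, and elsewhere the equation \<open>ua = vb\<close> bounds the degree of \<open>v\<close>.
\<close>

lemma ordering_division_overlap:
  assumes "v \<in> U" and "gt u v"
    and a: "a \<in> ordering_division n gt u U" and b: "b \<in> ordering_division n gt v U"
    and eq: "u + a = v + b"
  shows "\<exists>c\<in>ordering_division n gt v U. u = v + c"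
proof -
  have sum_eq: "Poly_Mapping.lookup u i + Poly_Mapping.lookup a i =
      Poly_Mapping.lookup v i + Poly_Mapping.lookup b i" for i
    using arg_cong[OF eq, of "\<lambda>p. Poly_Mapping.lookup p i"] by (simp add: lookup_add)
  have "Poly_Mapping.lookup v i \<le> Poly_Mapping.lookup u i" for i
  proof (cases "i \<in> Poly_Mapping.keys a")
    case True
    then have "\<not> nonmultiplicative gt u U i"
      using a by (simp add: mem_ordering_division_iff)
    then show ?thesis
      using \<open>v \<in> U\<close> \<open>gt u v\<close> by (auto simp: nonmultiplicative_def not_less)
  next
    case False
    then show ?thesis using sum_eq[of i] by (simp add: in_keys_iff)
  qed
  then have u: "u = v + (u - v)"
    by (intro poly_mapping_eqI) (simp add: lookup_add lookup_minus)
  have "v + b = v + ((u - v) + a)"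
    by (simp only: eq[symmetric] add.assoc[symmetric] u[symmetric])
  then have "b = (u - v) + a" by simp
  then have "u - v \<in> ordering_division n gt v U"
    using b ordering_division_factor_closed by blast
  with u show ?thesis by blast
qed

text \<open>
  Enlarging \<open>u\<close> to \<open>ua\<close> loses no obstruction: admissibility gives \<open>ua \<succeq> u\<close>, so a witness below
  \<open>u\<close> is also below \<open>ua\<close>, while \<open>a\<close> leaves the degree in every obstructed variable unchanged.
\<close>

lemma ordering_division_mono_cone:
  assumes adm: "admissible_ordering n gt"
    and U: "U \<subseteq> carrier (monomials n)" and "u \<in> U" "v \<in> U"
    and a: "a \<in> ordering_division n gt u U" and v: "v = u + a"
  shows "ordering_division n gt v U \<subseteq> ordering_division n gt u U"
proof -
  have "nonmultiplicative gt v U i" if nonmult: "nonmultiplicative gt u U i" for i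
  proof -
    obtain w where w: "w \<in> U" "gt u w" "Poly_Mapping.lookup u i < Poly_Mapping.lookup w i"
      using nonmult by (auto simp: nonmultiplicative_def)
    have carrier: "u \<in> carrier (monomials n)" "v \<in> carrier (monomials n)"
      "w \<in> carrier (monomials n)"
      using U \<open>u \<in> U\<close> \<open>v \<in> U\<close> w(1) by blast+
    have zero_carrier: "0 \<in> carrier (monomials n)" by simp
    have a_carrier: "a \<in> carrier (monomials n)"
      using a by (auto simp: mem_ordering_division_iff)
    have "i \<notin> Poly_Mapping.keys a"
      using a nonmult by (auto simp: mem_ordering_division_iff)
    then have same_degree: "Poly_Mapping.lookup v i = Poly_Mapping.lookup u i"
      by (simp add: v lookup_add in_keys_iff)
    have "gt v w"
    proof (cases "a = 0")
      case True
      then show ?thesis using v w(2) by simp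
    next
      case False
      then have "gt a 0"
        using adm a_carrier by (simp add: admissible_ordering_def Let_def)
      then have "gt (a + u) (0 + u)"
        using adm \<open>gt a 0\<close> a_carrier carrier zero_carrier
        unfolding admissible_ordering_def Let_def mult_monomials by blast
      then have "gt v u"
        by (simp add: v add.commute)
      moreover have "transp_on (carrier (monomials n)) gt"
        using adm by (simp add: admissible_ordering_def Let_def)
      ultimately show ?thesis
        using w(2) carrier by (meson transp_onD)
    qed
    then show ?thesis
      using w same_degree by (auto simp: nonmultiplicative_def)
  qed
  then show ?thesis unfolding subset_iff mem_ordering_division_iff by blast
qed

theorem proposition3p8:
  fixes n :: nat
    and gt :: "(nat \<Rightarrow>\<^sub>0 nat) \<Rightarrow> (nat \<Rightarrow>\<^sub>0 nat) \<Rightarrow> bool"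
  assumes "admissible_ordering n gt"
  shows "involutive_division n (ordering_division n gt)"
proof -
  let ?M = "monomials n" and ?D = "ordering_division n gt"
  have total: "totalp_on (carrier ?M) gt"
    using assms by (simp add: admissible_ordering_def Let_def)
  have overlap: "u \<in> v <#\<^bsub>?M\<^esub> ?D v U \<or> v \<in> u <#\<^bsub>?M\<^esub> ?D u U"
    if U: "U \<subseteq> carrier ?M" and uv: "u \<in> U" "v \<in> U"
      and meet: "(u <#\<^bsub>?M\<^esub> ?D u U) \<inter> (v <#\<^bsub>?M\<^esub> ?D v U) \<noteq> {}" for u v U
  proof -
    obtain a b where ab: "a \<in> ?D u U" "b \<in> ?D v U" "u + a = v + b"
      using meet by (auto simp: l_coset_def)
    consider "u = v" | "gt u v" | "gt v u"
      using totalp_onD[OF total, of u v] U uv by blast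
    then show ?thesis
    proof cases
      case 1
      have "0 \<in> ?D v U" by (simp add: mem_ordering_division_iff)
      then have "v \<in> v <#\<^bsub>?M\<^esub> ?D v U" unfolding mem_l_coset_monomials by force
      with 1 show ?thesis by simp
    next
      case 2
      then show ?thesis
        using ordering_division_overlap[OF uv(2) 2 ab] by (simp add: mem_l_coset_monomials)
    next
      case 3
      then show ?thesis
        using ordering_division_overlap[OF uv(1) 3 ab(2,1) ab(3)[symmetric]]
        by (simp add: mem_l_coset_monomials)
    qed
  qed
  show ?thesis
    unfolding involutive_division_def Let_def
  proof (intro allI impI conjI ballI; (elim conjE)?)
    show "submonoid (?D u U) ?M" for u U
      by (rule submonoid_ordering_division)
    show "v \<in> ?D u U" if "w \<in> ?D u U" "v divides\<^bsub>?M\<^esub> w" for u v w U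
      using that by (auto simp: factor_def intro: ordering_division_factor_closed)
    show "?D u U \<subseteq> ?D u V" if "V \<subseteq> U" for u U V
      using that by (rule ordering_division_antimono)
    show "?D v U \<subseteq> ?D u U"
      if "u \<in> U" "v \<in> U" "v \<in> u <#\<^bsub>?M\<^esub> ?D u U" "U \<subseteq> carrier ?M" for u v U
      using that ordering_division_mono_cone[OF assms] unfolding mem_l_coset_monomials by blast
    show "u \<in> v <#\<^bsub>?M\<^esub> ?D v U \<or> v \<in> u <#\<^bsub>?M\<^esub> ?D u U"
      if "u \<in> U" "v \<in> U" "(u <#\<^bsub>?M\<^esub> ?D u U) \<inter> (v <#\<^bsub>?M\<^esub> ?D v U) \<noteq> {}"
        "U \<subseteq> carrier ?M" for u v U
      using that(4,1-3) by (rule overlap)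
  qed
qed

end
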